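(* Let $n\ge 1$, $p,q\ge 0$ be integers, let $a_1,\dots,a_p$, $b_1,\dots,b_q$ be non-zero complex numbers with no $b_i$ a non-positive integer, and put $b_{q+1}=1$. Suppose that $$f(x)=\sum_{k=0}^\infty \frac{(a_1)_k(a_2)_k\cdots(a_p)_k}{(b_1)_k(b_2)_k\cdots(b_{q+1})_k}x^k$$ is an eigenfunction of $U_n$ corresponding to the eigenvalue $\lambda$, i.e. $U_n f=\lambda f$. Then $\lambda=1$, $p=q+1$ and, after a possible rearrangement of the parameters, $a_i=b_i$ for all $i$. Therefore $f(x)=\frac{1}{1-x}$.
   Context: All series are formal power series over $\mathbb{C}$, and $\frac1{1-x}$ denotes $\sum_{k\ge0}x^k$. The operator $U_n$ acts by $U_n\left(\sum_{k\ge0} c_k x^k\right) = \sum_{k\ge 0} c_{nk}x^k$. The ascending factorial is $(c)_0=1$, $(c)_k = c(c+1)\cdots(c+k-1)$.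
   Formalization: The condition n ≥ 1 is replaced by n ≥ 2: for n = 1 the operator U_1 is the identity, so every such f is an eigenfunction with λ = 1, e.g. p = q = 0 with f = ∑ x^k/k!, and the claim fails. *)

theory Defs
  imports
    "HOL-Computational_Algebra.Formal_Power_Series"
    "HOL-Library.Nonpos_Ints"
    "HOL-Combinatorics.Permutations"
begin

definition U_op :: "nat \<Rightarrow> complex fps \<Rightarrow> complex fps" where
  "U_op n f = Abs_fps (\<lambda>k. fps_nth f (n * k))"

(* The parameters are a 1, ..., a p and b 1, ..., b (q + 1); other values of a and b are irrelevant.
   The usual k! in the denominator is the factor for b (q + 1), once b (q + 1) = 1 is assumed. *)
definition hypergeom_series ::
    "nat \<Rightarrow> nat \<Rightarrow> (nat \<Rightarrow> complex) \<Rightarrow> (nat \<Rightarrow> complex) \<Rightarrow> complex fps" where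
  "hypergeom_series p q a b =
     Abs_fps (\<lambda>k. (\<Prod>i=1..p. pochhammer (a i) k) / (\<Prod>i=1..q+1. pochhammer (b i) k))"

(* The library quotient on formal power series is the geometric series. *)
lemma one_divide_one_minus_fps_X: "1 / (1 - fps_X) = Abs_fps (\<lambda>k. 1 :: complex)"
proof -
  have "(1 - fps_X) * Abs_fps (\<lambda>k. 1 :: complex) = 1"
    by (rule fps_ext) (simp add: left_diff_distrib)
  moreover have "(1 - fps_X :: complex fps) \<noteq> 0"
    using calculation by force
  ultimately show ?thesis
    by (metis nonzero_mult_div_cancel_left)
qed

end

theory Submission
  imports Defs "HOL-Computational_Algebra.Polynomial"
begin

text \<open>
  Write \<open>c k\<close> for the coefficients of \<open>f\<close>. Since \<open>c 0 = 1\<close>, the eigenvalue equation at \<open>k = 0\<close> forces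
  the eigenvalue 1, so \<open>c (n k) = c k\<close> for all \<open>k\<close>. In particular \<open>c (n ^ m) = c 1 \<noteq> 0\<close>, hence the
  series does not terminate and no coefficient vanishes.

  The ratio \<open>c (k + 1) / c k\<close> is \<open>A k / B k\<close> with \<open>A\<close> and \<open>B\<close> the monic polynomials
  \<open>\<Prod>i. (x + a i)\<close> and \<open>\<Prod>i. (x + b i)\<close>. The ratio \<open>c (n k + n) / c (n k)\<close> is on the one hand a product
  of \<open>n\<close> consecutive values of \<open>A / B\<close>, on the other hand again \<open>A k / B k\<close>. As rational functions,
  therefore, \<open>A x / B x = (\<Prod>j<n. A (n x + j) / B (n x + j))\<close>
  (\<open>dilation_invariant_imp_refinement_identity\<close>).

  Let \<open>D x\<close> be the order of \<open>A / B\<close> at \<open>x\<close>. Then \<open>D\<close> has finite support and satisfies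
  \<open>D x = (\<Sum>j<n. D (n x + j))\<close>. The heart of the proof is \<open>refinement_equation_only_zero_solution\<close>: the
  partial sums \<open>E x = (\<Sum>m. D (x + m))\<close> satisfy \<open>E x = E (n x)\<close>, so if \<open>E x \<noteq> 0\<close> then \<open>E\<close> is non-zero at
  all the points \<open>x / n ^ m\<close>. But \<open>E\<close> lives on finitely many cosets of the integers and these meet the
  disc of radius \<open>|x|\<close> in finitely many points, whence \<open>x = 0\<close>. The solutions are thus the multiples of
  a single one, that of the parameters \<open>a = 0\<close>, \<open>b = 1\<close>, and \<open>D 0 = 0\<close> leaves only \<open>D = 0\<close>. It holds
  because neither \<open>A\<close> nor \<open>B\<close> vanishes at 0.

  So \<open>D = 0\<close>, \<open>A\<close> and \<open>B\<close> have the same roots with multiplicity, the two families of parameters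
  agree as multisets, and every coefficient is 1.
\<close>

section \<open>A refinement equation for functions of finite support\<close>

text \<open>
  Contraction by \<open>n\<close> would copy a non-zero value of \<open>E x = (\<Sum>m. D (x + m))\<close> at \<open>x \<noteq> 0\<close> to infinitely many
  points accumulating at 0. At \<open>x = 0\<close> this argument says nothing, and indeed \<open>D 0 = 1\<close>,
  \<open>D (-1) = -1\<close>, \<open>D = 0\<close> elsewhere solves the equation; hence the condition \<open>D 0 = 0\<close>.
\<close>

lemma refinement_equation_only_zero_solution:
  fixes D :: "complex \<Rightarrow> int" and n :: nat
  assumes "n \<ge> 2" and fin: "finite {x. D x \<noteq> 0}" and "D 0 = 0"
    and refine: "\<And>x. D x = (\<Sum>j<n. D (of_nat n * x + of_nat j))"
  shows "D x = 0"
proof -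
  define S where "S = {x. D x \<noteq> 0}"
  define E where "E = (\<lambda>x. \<Sum>y | y \<in> S \<and> y - x \<in> \<nat>. D y)"
  have finS: "finite S" using fin by (simp add: S_def)

  \<comment> \<open>\<open>E\<close> is the sum of \<open>D (x + m)\<close> over all natural \<open>m\<close>, so \<open>D\<close> is minus its forward difference and
      the hypothesis relates the steps of \<open>E\<close> of length 1 at \<open>x\<close> and of length \<open>n\<close> at \<open>n x\<close>.\<close>
  have step: "E x = D x + E (x + 1)" for x
  proof -
    have "y - x \<in> \<nat> \<longleftrightarrow> y = x \<or> y - (x + 1) \<in> \<nat>" for y
    proof
      assume "y - x \<in> \<nat>"
      then obtain m where m: "y - x = of_nat m" by (auto elim: Nats_cases)
      show "y = x \<or> y - (x + 1) \<in> \<nat>"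
      proof (cases m)
        case 0
        with m show ?thesis by simp
      next
        case (Suc k)
        with m have "y - (x + 1) = of_nat k" by (simp add: algebra_simps)
        then show ?thesis by simp
      qed
    next
      assume "y = x \<or> y - (x + 1) \<in> \<nat>"
      moreover have "y - x = (y - (x + 1)) + 1" by simp
      ultimately show "y - x \<in> \<nat>" by (metis Nats_0 Nats_1 Nats_add diff_self)
    qed
    then have "{y. y \<in> S \<and> y - x \<in> \<nat>} = (S \<inter> {x}) \<union> {y. y \<in> S \<and> y - (x + 1) \<in> \<nat>}"
      by auto
    moreover have "x - (x + 1) \<notin> \<nat>"
    proof
      assume "x - (x + 1) \<in> \<nat>"
      then obtain m where "x - (x + 1) = of_nat m" by (auto elim: Nats_cases)
      then have "of_nat m = (- 1 :: complex)" by simp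
      then have "of_nat (Suc m) = (0 :: complex)" by simp
      then show False using of_nat_neq_0 by blast
    qed
    ultimately have "E x = sum D (S \<inter> {x}) + E (x + 1)"
      unfolding E_def using finS by (simp add: sum.union_disjoint disjoint_iff)
    also have "sum D (S \<inter> {x}) = D x" by (cases "x \<in> S") (auto simp: S_def)
    finally show ?thesis .
  qed
  have telescope: "E x = (\<Sum>j<m. D (x + of_nat j)) + E (x + of_nat m)" for x m
  proof (induction m)
    case (Suc m)
    then show ?case using step[of "x + of_nat m"] by (simp add: algebra_simps)
  qed simp

  define r where "r = (\<Sum>y\<in>S. norm y)"
  have r: "norm y \<le> r" if "y \<in> S" for y
    unfolding r_def using finS that by (intro member_le_sum) auto
  have E_right: "E x = 0" if "Re x > r" for x
  proof -
    have "y - x \<notin> \<nat>" if "y \<in> S" for y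
    proof
      assume "y - x \<in> \<nat>"
      then obtain k where "y - x = of_nat k" by (auto elim: Nats_cases)
      then have "Re (y - x) \<ge> 0" by (metis complex_Re_of_nat of_nat_0_le_iff)
      with r[OF that] complex_Re_le_cmod[of y] \<open>Re x > r\<close> show False by simp
    qed
    then show ?thesis unfolding E_def by (simp cong: conj_cong)
  qed

  \<comment> \<open>The difference \<open>E x - E (n x)\<close> is 1-periodic and vanishes far to the right.\<close>
  have dilate: "E x = E (of_nat n * x)" for x
  proof -
    have periodic: "E x - E (of_nat n * x) = E (x + of_nat m) - E (of_nat n * (x + of_nat m))"
      for m
    proof (induction m)
      case (Suc m)
      have "E (x + of_nat m) - E (x + of_nat m + 1)
          = E (of_nat n * (x + of_nat m)) - E (of_nat n * (x + of_nat m) + of_nat n)"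
        using step[of "x + of_nat m"] refine[of "x + of_nat m"]
          telescope[of "of_nat n * (x + of_nat m)" n] by simp
      with Suc show ?case by (simp add: algebra_simps)
    qed simp
    obtain m :: nat where m: "real m > \<bar>r\<bar> + \<bar>Re x\<bar>" using reals_Archimedean2 by blast
    have "Re (x + of_nat m) > r" "0 \<le> Re (x + of_nat m)" using m by auto
    moreover from this have "Re (x + of_nat m) * 1 \<le> Re (x + of_nat m) * real n"
      using \<open>n \<ge> 2\<close> by (intro mult_left_mono) auto
    then have "Re (x + of_nat m) \<le> Re (of_nat n * (x + of_nat m))"
      by (simp add: mult.commute)
    ultimately show ?thesis using periodic[of m] E_right by fastforce
  qed

  have E_off_zero: "E x = 0" if "x \<noteq> 0" for x
  proof (rule ccontr)
    assume "E x \<noteq> 0"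
    define z where "z = (\<lambda>m. x / of_nat n ^ m)"
    have n0: "(of_nat n :: complex) \<noteq> 0" using \<open>n \<ge> 2\<close> by simp
    have "E (z m) = E x" for m
    proof (induction m)
      case (Suc m)
      have "of_nat n * z (Suc m) = z m" using n0 by (simp add: z_def)
      then show ?case using dilate[of "z (Suc m)"] Suc by simp
    qed (simp add: z_def)
    then have "\<exists>y\<in>S. y - z m \<in> \<nat>" for m
      using \<open>E x \<noteq> 0\<close> unfolding E_def by (metis (no_types, lifting) empty_Collect_eq sum.empty)
    then have ex: "\<exists>y\<in>S. \<exists>k. z m = y - of_nat k" for m
      by (metis Nats_cases diff_diff_eq2 add_diff_cancel_left')
    \<comment> \<open>All \<open>z m\<close> lie in the disc of radius \<open>|x|\<close> and the support in that of radius \<open>r\<close>, so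
        \<open>K\<close> bounds the integer by which \<open>z m\<close> differs from a point of the support.\<close>
    obtain K :: nat where K: "real K \<ge> r + norm x" using real_arch_simple by blast
    have "range z \<subseteq> (\<lambda>(y, k). y - of_nat k) ` (S \<times> {..K})"
    proof
      fix w assume "w \<in> range z"
      then obtain m where w: "w = z m" by auto
      obtain y k where yk: "y \<in> S" "z m = y - of_nat k" using ex by blast
      have "norm (z m) \<le> norm x"
        using \<open>n \<ge> 2\<close> by (simp add: z_def norm_divide norm_power divide_le_eq mult_le_cancel_left1)
      moreover have "real k = norm (y - z m)" using yk by simp
      ultimately have "real k \<le> real K"
        using r[OF yk(1)] K norm_triangle_ineq4[of y "z m"] by linarith
      then show "w \<in> (\<lambda>(y, k). y - of_nat k) ` (S \<times> {..K})"
        using w yk by force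
    qed
    then have "finite (range z)" by (rule finite_subset) (use finS in auto)
    moreover have "inj z"
    proof
      fix i j assume "z i = z j"
      then have "(of_nat (n ^ i) :: complex) = of_nat (n ^ j)"
        using that n0 by (simp add: z_def divide_simps)
      then have "n ^ i = n ^ j" using of_nat_eq_iff by blast
      then show "i = j" using \<open>n \<ge> 2\<close> by (simp add: power_inject_exp)
    qed
    ultimately show False using finite_imageD infinite_UNIV_nat by blast
  qed
  have "E 0 = 0" using step[of 0] E_off_zero[of 1] \<open>D 0 = 0\<close> by simp
  then have "E y = 0" for y using E_off_zero by (cases "y = 0") auto
  then show ?thesis using step[of x] by simp
qed

section \<open>Orders of polynomials and their dilates\<close>

lemma order_pcompose_linear:
  fixes P :: "'a::field_char_0 poly"
  assumes "P \<noteq> 0" "d \<noteq> 0"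
  shows "order x (pcompose P [:c, d:]) = order (c + d * x) P"
proof -
  define y where "y = c + d * x"
  obtain Q where Q: "P = [:-y, 1:] ^ order y P * Q" "\<not> [:-y, 1:] dvd Q"
    using order_decomp[OF assms(1)] by blast
  have "pcompose [:-y, 1:] [:c, d:] = smult d [:-x, 1:]"
    by (simp add: pcompose_pCons y_def)
  moreover have "pcompose (R ^ m) [:c, d:] = pcompose R [:c, d:] ^ m" for R :: "'a poly" and m
    by (induction m) (simp_all add: pcompose_mult pcompose_1)
  then have "pcompose P [:c, d:] = pcompose [:-y, 1:] [:c, d:] ^ order y P * pcompose Q [:c, d:]"
    by (subst Q(1)) (simp add: pcompose_mult del: pcompose_pCons)
  ultimately have *: "pcompose P [:c, d:]
      = [:-x, 1:] ^ order y P * smult (d ^ order y P) (pcompose Q [:c, d:])"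
    by (simp only: smult_power mult_smult_left mult_smult_right)
  have "poly Q y \<noteq> 0" using Q(2) by (simp add: poly_eq_0_iff_dvd)
  then have "poly (smult (d ^ order y P) (pcompose Q [:c, d:])) x \<noteq> 0"
    using assms(2) by (simp add: poly_pcompose y_def mult.commute)
  then have "\<not> [:-x, 1:] dvd smult (d ^ order y P) (pcompose Q [:c, d:])"
    by (simp only: poly_eq_0_iff_dvd not_False_eq_True)
  then have "\<not> [:-x, 1:] ^ Suc (order y P) dvd pcompose P [:c, d:]"
    by (subst *, subst power_Suc2, subst dvd_mult_cancel_left) simp
  moreover have "[:-x, 1:] ^ order y P dvd pcompose P [:c, d:]"
    using * by (rule dvdI)
  ultimately show ?thesis
    using order_unique_lemma unfolding y_def by blast
qed

lemma order_prod:
  fixes P :: "'b \<Rightarrow> 'a::idom poly"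
  assumes "\<And>j. j \<in> J \<Longrightarrow> P j \<noteq> 0"
  shows "order x (\<Prod>j\<in>J. P j) = (\<Sum>j\<in>J. order x (P j))"
  using assms
proof (induction J rule: infinite_finite_induct)
  case (insert j J)
  then show ?case by (simp add: order_mult)
qed auto

text \<open>
  The identity says that \<open>A / B\<close> equals the product of its \<open>n\<close> translated dilates. Orders turn
  products into sums, so the order of \<open>A / B\<close> solves the refinement equation; it is 0 at 0 by the
  two conditions there.
\<close>

lemma refinement_identity_imp_order_eq:
  fixes A B :: "complex poly"
  assumes "n \<ge> 2" and "poly A 0 \<noteq> 0" and "poly B 0 \<noteq> 0"
    and identity: "A * (\<Prod>j<n. pcompose B [:of_nat j, of_nat n:])
                 = B * (\<Prod>j<n. pcompose A [:of_nat j, of_nat n:])"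
  shows "order x A = order x B"
proof -
  have nz: "A \<noteq> 0" "B \<noteq> 0" using assms by auto
  have n0: "(of_nat n :: complex) \<noteq> 0" using \<open>n \<ge> 2\<close> by simp
  have comp_nz: "pcompose P [:of_nat j, of_nat n:] \<noteq> 0" if "P \<noteq> 0" for P :: "complex poly" and j
    using that n0 pcompose_eq_0[of P "[:of_nat j, of_nat n:]"] by auto
  have order_sides: "order x (P * (\<Prod>j<n. pcompose Q [:of_nat j, of_nat n:]))
      = order x P + (\<Sum>j<n. order (of_nat n * x + of_nat j) Q)"
    if "P \<noteq> 0" "Q \<noteq> 0" for P Q :: "complex poly" and x
    using that comp_nz[OF that(2)] n0
    by (simp add: order_mult order_prod order_pcompose_linear add.commute)
  define D where "D = (\<lambda>x. int (order x A) - int (order x B))"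
  have "D x = (\<Sum>j<n. D (of_nat n * x + of_nat j))" for x
    using order_sides[OF nz, of x] order_sides[OF nz(2,1), of x] identity
    by (simp add: D_def sum_subtractf flip: of_nat_sum)
  moreover have "finite {x. D x \<noteq> 0}"
  proof (rule finite_subset)
    show "{x. D x \<noteq> 0} \<subseteq> {x. poly A x = 0} \<union> {x. poly B x = 0}"
      using nz by (auto simp: D_def order_root)
    show "finite ({x. poly A x = 0} \<union> {x. poly B x = 0})"
      using nz by (simp add: poly_roots_finite)
  qed
  moreover have "D 0 = 0" using assms(2,3) by (simp add: D_def order_0I)
  ultimately have "D x = 0"
    using refinement_equation_only_zero_solution[OF \<open>n \<ge> 2\<close>] by blast
  then show ?thesis by (simp add: D_def)
qed


lemma proots_prod_linear_factors:
  fixes g :: "'b \<Rightarrow> 'a::idom"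
  assumes "finite I"
  shows "proots (\<Prod>i\<in>I. [:g i, 1:]) = image_mset (\<lambda>i. - g i) (mset_set I)"
proof -
  have "proots (\<Prod>i\<in>I. [:g i, 1:]) = (\<Sum>i\<in>I. {#- g i#})"
    by (subst proots_prod) simp_all
  also have "\<dots> = image_mset (\<lambda>i. - g i) (mset_set I)"
    using assms by (induction I rule: finite_induct) simp_all
  finally show ?thesis .
qed

section \<open>Sequences with rational ratio that are invariant under dilation\<close>

text \<open>
  The quotient \<open>c (n (k + 1)) / c (n k)\<close> can be computed in one step by invariance, or in \<open>n\<close> steps by
  the recurrence. Comparing the two gives the identity at every natural number \<open>k\<close>, which is enough for
  polynomials.
\<close>

lemma dilation_invariant_imp_refinement_identity:
  fixes c :: "nat \<Rightarrow> 'a::field_char_0" and A B :: "'a poly"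
  assumes nonzero: "\<And>k. c k \<noteq> 0"
    and dilate: "\<And>k. c (n * k) = c k"
    and recurrence: "\<And>k. c (Suc k) * poly B (of_nat k) = c k * poly A (of_nat k)"
  shows "A * (\<Prod>j<n. pcompose B [:of_nat j, of_nat n:])
       = B * (\<Prod>j<n. pcompose A [:of_nat j, of_nat n:])" (is "?L = ?R")
proof -
  have iterate: "c (k + m) * (\<Prod>j<m. poly B (of_nat (k + j)))
      = c k * (\<Prod>j<m. poly A (of_nat (k + j)))" for k m
  proof (induction m)
    case (Suc m)
    have "c (k + Suc m) * (\<Prod>j<Suc m. poly B (of_nat (k + j)))
        = (c (Suc (k + m)) * poly B (of_nat (k + m))) * (\<Prod>j<m. poly B (of_nat (k + j)))"
      by simp
    also have "\<dots> = (c (k + m) * (\<Prod>j<m. poly B (of_nat (k + j)))) * poly A (of_nat (k + m))"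
      by (simp only: recurrence mult_ac)
    also have "\<dots> = c k * (\<Prod>j<Suc m. poly A (of_nat (k + j)))"
      by (simp only: Suc) simp
    finally show ?case .
  qed simp
  have agree: "poly ?L (of_nat k) = poly ?R (of_nat k)" for k
  proof -
    define PA where "PA = (\<Prod>j<n. poly A (of_nat (n * k + j)))"
    define PB where "PB = (\<Prod>j<n. poly B (of_nat (n * k + j)))"
    have "c (Suc k) * PB = c k * PA"
      using iterate[of "n * k" n] dilate[of k] dilate[of "Suc k"]
      by (simp add: PA_def PB_def add.commute)
    then have "c k * (poly A (of_nat k) * PB) = c k * (poly B (of_nat k) * PA)"
      using recurrence[of k] by (metis mult.assoc mult.left_commute)
    then have "poly A (of_nat k) * PB = poly B (of_nat k) * PA" using nonzero by simp
    then show ?thesis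
      by (simp add: PA_def PB_def poly_prod poly_pcompose add.commute mult.commute)
  qed
  show "?L = ?R"
  proof (rule ccontr)
    assume "?L \<noteq> ?R"
    then have "finite {z. poly (?L - ?R) z = 0}" by (intro poly_roots_finite) simp
    moreover have "range of_nat \<subseteq> {z. poly (?L - ?R) z = 0}" using agree by auto
    ultimately have "finite (range (of_nat :: nat \<Rightarrow> 'a))" by (rule rev_finite_subset)
    then show False using finite_imageD inj_of_nat infinite_UNIV_nat by blast
  qed
qed

section \<open>Hypergeometric eigenfunctions\<close>

theorem theorem6p6:
  fixes n p q :: nat and a b :: "nat \<Rightarrow> complex" and lam :: complex and f :: "complex fps"
  assumes "n \<ge> 2"
    and "\<And>i. i \<in> {1..p} \<Longrightarrow> a i \<noteq> 0"
    and "\<And>i. i \<in> {1..q} \<Longrightarrow> b i \<noteq> 0"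
    and "\<And>i. i \<in> {1..q} \<Longrightarrow> b i \<notin> \<int>\<^sub>\<le>\<^sub>0"
    and "b (q + 1) = 1"
    and "f = hypergeom_series p q a b"
    and "U_op n f = fps_const lam * f"
  shows "lam = 1 \<and> p = q + 1 \<and>
    (\<exists>\<sigma>. \<sigma> permutes {1..p} \<and> (\<forall>i\<in>{1..p}. a (\<sigma> i) = b i)) \<and>
    f = 1 / (1 - fps_X)"
proof -
  define c where "c = fps_nth f"
  have c_eq: "c k = (\<Prod>i=1..p. pochhammer (a i) k) / (\<Prod>i=1..q+1. pochhammer (b i) k)" for k
    by (simp add: c_def assms(6) hypergeom_series_def)
  have b_regular: "b i + of_nat k \<noteq> 0" if "i \<in> {1..q+1}" for i k
  proof
    assume "b i + of_nat k = 0"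
    then have "b i = - of_nat k" by (simp add: add_eq_0_iff2)
    moreover have "b i \<notin> \<int>\<^sub>\<le>\<^sub>0"
    proof (cases "i = q + 1")
      case True
      then show ?thesis using assms(5) by (simp del: One_nat_def)
    next
      case False
      then show ?thesis using assms(4)[of i] that by simp
    qed
    ultimately show False by simp
  qed
  have b_poch: "pochhammer (b i) k \<noteq> 0" if "i \<in> {1..q+1}" for i k
    using that b_regular by (metis pochhammer_eq_0_iff add.left_inverse)
  have b_prod: "(\<Prod>i=1..q+1. pochhammer (b i) k) \<noteq> 0" for k
    using b_poch by (subst prod_zero_iff) blast+

  have eigen: "c (n * k) = lam * c k" for k
  proof -
    have "fps_nth (U_op n f) k = fps_nth (fps_const lam * f) k" using assms(7) by simp
    then show ?thesis by (simp add: U_op_def c_def)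
  qed
  have "c 0 = 1" by (simp add: c_eq)
  then have lam: "lam = 1" using eigen[of 0] by simp
  then have c_dilate: "c (n * k) = c k" for k using eigen by simp

  have c_nz: "c k \<noteq> 0" for k
  proof
    assume "c k = 0"
    then have "(\<Prod>i=1..p. pochhammer (a i) k) = 0" using b_prod[of k] by (simp add: c_eq)
    then obtain i where i: "i \<in> {1..p}" "pochhammer (a i) k = 0" by (auto simp: prod_zero_iff)
    \<comment> \<open>A vanishing coefficient makes the series a polynomial, but \<open>c 1\<close> recurs at every power of \<open>n\<close>.\<close>
    have "k < n ^ k" using \<open>n \<ge> 2\<close> by (intro power_gt_expt) simp
    then have "pochhammer (a i) (n ^ k) = 0" using i(2) by (auto intro: pochhammer_eq_0_mono)
    then have "c (n ^ k) = 0" using i(1) by (auto simp: c_eq)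
    moreover have "c (n ^ m) = c 1" for m by (induction m) (simp_all add: c_dilate)
    moreover have "c 1 \<noteq> 0" using assms(2) b_prod[of 1] by (auto simp: c_eq)
    ultimately show False by simp
  qed

  define A where "A = (\<Prod>i\<in>{1..p}. [:a i, 1:])"
  define B where "B = (\<Prod>i\<in>{1..q+1}. [:b i, 1:])"
  have poly_A: "poly A z = (\<Prod>i\<in>{1..p}. a i + z)"
    and poly_B: "poly B z = (\<Prod>i\<in>{1..q+1}. b i + z)" for z
    unfolding A_def B_def by (simp_all only: poly_prod) simp_all
  have recurrence: "c (Suc k) * poly B (of_nat k) = c k * poly A (of_nat k)" for k
    using b_prod[of k] b_prod[of "Suc k"]
    unfolding c_eq poly_A poly_B
    by (simp only: pochhammer_Suc prod.distrib) (simp add: field_simps del: prod.cl_ivl_Suc)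
  have "poly A 0 \<noteq> 0" using assms(2) by (auto simp: poly_A prod_zero_iff)
  moreover have "poly B 0 \<noteq> 0"
    using b_regular[of _ 0] by (auto simp: poly_B prod_zero_iff simp del: prod.cl_ivl_Suc)
  ultimately have "order z A = order z B" for z
    using refinement_identity_imp_order_eq[OF \<open>n \<ge> 2\<close>]
      dilation_invariant_imp_refinement_identity[OF c_nz c_dilate recurrence] by blast
  moreover have "A \<noteq> 0" "B \<noteq> 0" using \<open>poly A 0 \<noteq> 0\<close> \<open>poly B 0 \<noteq> 0\<close> by auto
  ultimately have "proots A = proots B" by (intro multiset_eqI) simp
  then have "image_mset (\<lambda>i. - a i) (mset_set {1..p}) = image_mset (\<lambda>i. - b i) (mset_set {1..q+1})"
    unfolding A_def B_def by (simp only: proots_prod_linear_factors finite_atLeastAtMost)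
  then have "image_mset uminus (image_mset (\<lambda>i. - a i) (mset_set {1..p}))
      = image_mset uminus (image_mset (\<lambda>i. - b i) (mset_set {1..q+1}))"
    by (rule arg_cong)
  then have ms: "image_mset a (mset_set {1..p}) = image_mset b (mset_set {1..q+1})"
    by (simp only: multiset.map_comp comp_def minus_minus)
  then have "size (image_mset a (mset_set {1..p})) = size (image_mset b (mset_set {1..q+1}))"
    by (rule arg_cong)
  then have p: "p = q + 1" by simp
  have "image_mset b (mset_set {1..p}) = image_mset a (mset_set {1..p})" using ms p by simp
  then obtain \<sigma> where \<sigma>: "\<sigma> permutes {1..p}" "\<forall>i\<in>{1..p}. b i = a (\<sigma> i)"
    using image_mset_eq_implies_permutes[OF finite_atLeastAtMost] by blast

  have "c k = 1" for k
  proof -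
    have "(\<Prod>i=1..p. pochhammer (a i) k) = (\<Prod>i=1..p. pochhammer (a (\<sigma> i)) k)"
      using prod.permute[OF \<sigma>(1), of "\<lambda>i. pochhammer (a i) k"] by (simp add: comp_def)
    also have "\<dots> = (\<Prod>i=1..p. pochhammer (b i) k)" using \<sigma>(2) by (intro prod.cong) auto
    finally show ?thesis using b_prod[of k] p by (simp add: c_eq del: prod.cl_ivl_Suc)
  qed
  then have "f = 1 / (1 - fps_X)"
    unfolding one_divide_one_minus_fps_X by (intro fps_ext) (simp add: c_def)
  with lam p \<sigma> show ?thesis by force
qed

end
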